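(* Let $X\subseteq\mathbb{N}^2$. Let $S\subseteq\mathbb{N}$ be finite with $|S|=n$, and let $I\subseteq[n-1]$ be nonempty. Write $m=\max(I)$ and $I^-=I\setminus\{m\}$. Then \[ d_X(I;S)=\sum_{\substack{A\subseteq S\\ |A|=m}} d_X(I^-;A)\,d_X(\emptyset;S\setminus A)\;-\;d_X(I^-;S). \]
   Context: $[n]=\{1,\dots,n\}$. For a finite $S\subseteq\mathbb{N}$ with $|S|=n$, $\mathfrak{S}_S$ denotes the set of bijections $\pi:[n]\to S$, written in one-line notation $\pi=\pi_1\cdots\pi_n$. For $X\subseteq\mathbb{N}^2$, the $X$-descent set of $\pi$ is $\mathrm{XDes}(\pi)=\{i\in[n-1]:(\pi_i,\pi_{i+1})\in X\}$. For $I\subseteq[n-1]$, $d_X(I;S)$ is the number of $\pi\in\mathfrak{S}_S$ with $\mathrm{XDes}(\pi)=I$. (For $|S|=k$ the relevant index set is $[k-1]$.) *)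

theory Defs
  imports Main "HOL-Library.FuncSet"
begin

text \<open>Bijections from \<open>{1..card S}\<close> onto \<open>S\<close>. They are taken to be extensional, so that each
  bijection is represented by exactly one HOL function and can be counted with \<open>card\<close>.\<close>

definition perms_of :: "nat set \<Rightarrow> (nat \<Rightarrow> nat) set" where
  "perms_of S = {\<pi> \<in> extensional {1..card S}. bij_betw \<pi> {1..card S} S}"

definition XDes :: "(nat \<times> nat) set \<Rightarrow> nat \<Rightarrow> (nat \<Rightarrow> nat) \<Rightarrow> nat set" where
  "XDes X n \<pi> = {i \<in> {1..n - 1}. (\<pi> i, \<pi> (i + 1)) \<in> X}"

definition d :: "(nat \<times> nat) set \<Rightarrow> nat set \<Rightarrow> nat set \<Rightarrow> nat" where
  "d X I S = card {\<pi> \<in> perms_of S. XDes X (card S) \<pi> = I}"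

end

theory Submission
  imports Defs
begin

text \<open>Cutting a permutation of \<open>S\<close> after position \<open>m\<close> is a bijection onto the triples consisting of
  a subset \<open>A\<close> of size \<open>m\<close>, a permutation of \<open>A\<close> and a permutation of \<open>S - A\<close>. It preserves all
  \<open>X\<close>-descents except the one that may occur at \<open>m\<close>. Hence the sum counts the permutations whose
  descent set agrees with \<open>I\<close> outside \<open>m\<close>, that is, those with descent set \<open>I\<close> or \<open>I - {m}\<close>.\<close>

text \<open>Functions carry no length, so the cut position \<open>m\<close> and the total length
  \<open>n\<close> are parameters. The restriction to \<open>{1..n}\<close> makes the result
  extensional, as \<open>perms_of\<close> demands.\<close>

definition perm_append :: "nat \<Rightarrow> nat \<Rightarrow> (nat \<Rightarrow> nat) \<Rightarrow> (nat \<Rightarrow> nat) \<Rightarrow> nat \<Rightarrow> nat" where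
  "perm_append m n \<sigma> \<tau> = (\<lambda>i\<in>{1..n}. if i \<le> m then \<sigma> i else \<tau> (i - m))"

lemma finite_perms_of:
  assumes "finite S"
  shows "finite (perms_of S)"
proof (rule finite_subset)
  show "perms_of S \<subseteq> {1..card S} \<rightarrow>\<^sub>E S"
    by (auto simp: perms_of_def PiE_def bij_betw_def)
  show "finite ({1..card S} \<rightarrow>\<^sub>E S)"
    using assms by (simp add: finite_PiE)
qed

lemma image_perm_append:
  assumes "m \<le> n"
  shows "perm_append m n \<sigma> \<tau> ` {1..m} = \<sigma> ` {1..m}"
    and "perm_append m n \<sigma> \<tau> ` {m<..n} = \<tau> ` {1..n - m}"
proof -
  show "perm_append m n \<sigma> \<tau> ` {1..m} = \<sigma> ` {1..m}"
    using assms by (intro image_cong) (auto simp: perm_append_def)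
  have "{m<..n} = (\<lambda>i. i + m) ` {1..n - m}"
    using assms by (simp only: image_add_atLeastAtMost') auto
  then have "perm_append m n \<sigma> \<tau> ` {m<..n} = (\<lambda>i. perm_append m n \<sigma> \<tau> (i + m)) ` {1..n - m}"
    by (simp only: image_image)
  also have "\<dots> = \<tau> ` {1..n - m}"
    using assms by (intro image_cong) (auto simp: perm_append_def)
  finally show "perm_append m n \<sigma> \<tau> ` {m<..n} = \<tau> ` {1..n - m}" .
qed

lemma perm_append_in_perms_of:
  assumes "finite S" "A \<subseteq> S" "\<sigma> \<in> perms_of A" "\<tau> \<in> perms_of (S - A)"
  shows "perm_append (card A) (card S) \<sigma> \<tau> \<in> perms_of S"
proof -
  let ?m = "card A" and ?n = "card S"
  have le: "?m \<le> ?n"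
    using assms by (simp add: card_mono)
  have card_diff: "card (S - A) = ?n - ?m"
    using assms by (simp add: card_Diff_subset finite_subset)
  have split: "{1..?n} = {1..?m} \<union> {?m<..?n}"
    using le by auto
  have "perm_append ?m ?n \<sigma> \<tau> ` {1..?n} = A \<union> (S - A)"
    unfolding split image_Un image_perm_append[OF le]
    using assms(3,4) by (simp add: perms_of_def bij_betw_def card_diff)
  then have img: "perm_append ?m ?n \<sigma> \<tau> ` {1..?n} = S"
    using assms(2) by auto
  \<comment> \<open>A map from \<open>{1..card S}\<close> onto a set with \<open>card S\<close>
    elements is injective by counting.\<close>
  then have "inj_on (perm_append ?m ?n \<sigma> \<tau>) {1..?n}"
    by (intro eq_card_imp_inj_on) simp_all
  with img show ?thesis
    by (simp add: perms_of_def bij_betw_def perm_append_def)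
qed

lemma bij_betw_perm_append:
  assumes "finite S" "m \<le> card S"
  shows "bij_betw (\<lambda>(A, \<sigma>, \<tau>). perm_append m (card S) \<sigma> \<tau>)
    (SIGMA A:{A. A \<subseteq> S \<and> card A = m}. perms_of A \<times> perms_of (S - A)) (perms_of S)"
proof (rule bij_betw_byWitness)
  let ?n = "card S"
  let ?f = "\<lambda>(A, \<sigma>, \<tau>). perm_append m ?n \<sigma> \<tau>"
  \<comment> \<open>The inverse cuts after position \<open>m\<close>: the set of the first
    \<open>m\<close> values, the prefix, and the suffix shifted down to start at 1. Both pieces are
    restricted so that they are extensional again.\<close>
  let ?g = "\<lambda>\<pi>. (\<pi> ` {1..m}, restrict \<pi> {1..m}, \<lambda>i\<in>{1..?n - m}. \<pi> (i + m))"
  let ?T = "SIGMA A:{A. A \<subseteq> S \<and> card A = m}. perms_of A \<times> perms_of (S - A)"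
  have card_diff: "card (S - A) = ?n - m" if "A \<subseteq> S" "card A = m" for A
    using that assms by (simp add: card_Diff_subset finite_subset)
  show "\<forall>z\<in>?T. ?g (?f z) = z"
  proof
    fix z assume "z \<in> ?T"
    then obtain A \<sigma> \<tau> where z: "z = (A, \<sigma>, \<tau>)" and A: "A \<subseteq> S" "card A = m"
      and \<sigma>: "\<sigma> \<in> perms_of A" and \<tau>: "\<tau> \<in> perms_of (S - A)"
      by blast
    let ?p = "perm_append m ?n \<sigma> \<tau>"
    have "?p ` {1..m} = A"
      unfolding image_perm_append(1)[OF assms(2)] using A \<sigma> by (simp add: perms_of_def bij_betw_def)
    moreover have "restrict ?p {1..m} = \<sigma>"
    proof (rule extensionalityI)
      show "\<sigma> \<in> extensional {1..m}"
        using A \<sigma> by (simp add: perms_of_def)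
    qed (use assms in \<open>auto simp: perm_append_def\<close>)
    moreover have "(\<lambda>i\<in>{1..?n - m}. ?p (i + m)) = \<tau>"
    proof (rule extensionalityI)
      show "\<tau> \<in> extensional {1..?n - m}"
        using \<tau> card_diff[OF A] by (simp add: perms_of_def)
    qed (use assms in \<open>auto simp: perm_append_def\<close>)
    ultimately show "?g (?f z) = z"
      by (simp add: z)
  qed
  show "\<forall>\<pi>\<in>perms_of S. ?f (?g \<pi>) = \<pi>"
  proof
    fix \<pi> assume "\<pi> \<in> perms_of S"
    \<comment> \<open>Extensionality settles the positions outside \<open>{1..card S}\<close>, where
      both sides are \<open>undefined\<close>.\<close>
    then have "\<pi> \<in> extensional {1..?n}"
      by (simp add: perms_of_def)
    then show "?f (?g \<pi>) = \<pi>"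
      by (auto simp: perm_append_def extensional_def fun_eq_iff)
  qed
  show "?f ` ?T \<subseteq> perms_of S"
    using perm_append_in_perms_of[OF assms(1)] by auto
  show "?g ` perms_of S \<subseteq> ?T"
  proof (rule image_subsetI)
    fix \<pi> assume "\<pi> \<in> perms_of S"
    then have inj: "inj_on \<pi> {1..?n}" and img: "\<pi> ` {1..?n} = S"
      by (simp_all add: perms_of_def bij_betw_def)
    let ?A = "\<pi> ` {1..m}" and ?\<tau> = "\<lambda>i\<in>{1..?n - m}. \<pi> (i + m)"
    have inj_m: "inj_on \<pi> {1..m}"
      by (rule inj_on_subset[OF inj]) (use assms in auto)
    have A: "?A \<subseteq> S" "card ?A = m"
      using img assms(2) inj_m by (auto simp: card_image)
    have "restrict \<pi> {1..m} \<in> perms_of ?A"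
      using inj_m A(2) by (simp add: perms_of_def bij_betw_def inj_on_restrict_eq)
    moreover have "?\<tau> \<in> perms_of (S - ?A)"
    proof -
      have "inj_on ?\<tau> {1..?n - m}"
        using assms(2) by (auto intro!: inj_onI dest!: inj_onD[OF inj])
      moreover have "?\<tau> ` {1..?n - m} = S - ?A"
      proof -
        have "?\<tau> ` {1..?n - m} = \<pi> ` (\<lambda>i. i + m) ` {1..?n - m}"
          unfolding image_image by (intro image_cong) simp_all
        also have "(\<lambda>i. i + m) ` {1..?n - m} = {1..?n} - {1..m}"
          using assms(2) by (simp only: image_add_atLeastAtMost') auto
        \<comment> \<open>Injectivity of \<open>\<pi>\<close> makes the later values exactly the
          complement of the first \<open>m\<close> values.\<close>
        also have "\<pi> ` ({1..?n} - {1..m}) = S - ?A"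
          using inj_on_image_set_diff[OF inj, of "{1..?n}" "{1..m}"] assms(2) img by auto
        finally show ?thesis .
      qed
      ultimately show ?thesis
        unfolding perms_of_def card_diff[OF A] bij_betw_def using restrict_extensional by blast
    qed
    ultimately show "?g \<pi> \<in> ?T"
      using A by simp
  qed
qed

text \<open>Whether \<open>i\<close> is a descent depends on positions \<open>i\<close> and
  \<open>i + 1\<close>. Both lie in the prefix if \<open>i < m\<close> and both in the suffix if
  \<open>i > m\<close>; only \<open>i = m\<close> straddles the cut.\<close>

lemma XDes_perm_append:
  assumes "m \<le> n"
  shows "XDes X n (perm_append m n \<sigma> \<tau>) - {m} = XDes X m \<sigma> \<union> (\<lambda>i. i + m) ` XDes X (n - m) \<tau>"
proof (intro set_eqI)
  fix i
  consider "i < m" | "i = m" | "m < i"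
    by linarith
  then show "i \<in> XDes X n (perm_append m n \<sigma> \<tau>) - {m} \<longleftrightarrow>
    i \<in> XDes X m \<sigma> \<union> (\<lambda>i. i + m) ` XDes X (n - m) \<tau>"
  proof cases
    case 3
    \<comment> \<open>As \<open>m < i\<close>, the truncated difference \<open>i - m\<close> is the
      unique preimage of \<open>i\<close> under the shift.\<close>
    then have "i \<in> (\<lambda>i. i + m) ` XDes X (n - m) \<tau> \<longleftrightarrow> i - m \<in> XDes X (n - m) \<tau>"
      by (auto simp: image_iff intro!: bexI[of _ "i - m"])
    with 3 show ?thesis
      by (auto simp: XDes_def perm_append_def Suc_diff_le)
  qed (use assms in \<open>auto simp: XDes_def perm_append_def\<close>)
qed

text \<open>Prefix descents lie below \<open>m\<close> and shifted suffix descents do not, so an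
  equation with a set \<open>J\<close> below \<open>m\<close> splits into one condition on each
  piece.\<close>

lemma XDes_perm_append_eq_iff:
  assumes "m \<le> n" "J \<subseteq> {..<m}"
  shows "XDes X n (perm_append m n \<sigma> \<tau>) - {m} = J \<longleftrightarrow> XDes X m \<sigma> = J \<and> XDes X (n - m) \<tau> = {}"
proof -
  have "(\<lambda>i. i + m) ` XDes X (n - m) \<tau> \<inter> {..<m} = {}"
    by auto
  moreover have "XDes X m \<sigma> \<subseteq> {..<m}"
    by (auto simp: XDes_def)
  ultimately show ?thesis
    unfolding XDes_perm_append[OF assms(1)] using assms(2) by blast
qed

text \<open>Along the cutting bijection the condition becomes independent conditions on prefix and
  suffix, so each \<open>A\<close> contributes a product.\<close>

lemma card_XDes_except:
  assumes "finite S" "m \<le> card S" "J \<subseteq> {..<m}"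
  shows "card {\<pi> \<in> perms_of S. XDes X (card S) \<pi> - {m} = J} =
    (\<Sum>A\<in>{A. A \<subseteq> S \<and> card A = m}. d X J A * d X {} (S - A))"
proof -
  let ?f = "\<lambda>(A, \<sigma>, \<tau>). perm_append m (card S) \<sigma> \<tau>"
  let ?\<A> = "{A. A \<subseteq> S \<and> card A = m}"
  let ?T = "SIGMA A:?\<A>. perms_of A \<times> perms_of (S - A)"
  let ?D = "\<lambda>J A. {\<pi> \<in> perms_of A. XDes X (card A) \<pi> = J}"
  have fin: "finite A" "finite (S - A)" if "A \<in> ?\<A>" for A
    using that assms(1) finite_subset by auto
  have card_diff: "card (S - A) = card S - m" if "A \<in> ?\<A>" for A
    using that assms(1) by (auto simp: card_Diff_subset finite_subset)
  have bij: "bij_betw ?f ?T (perms_of S)"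
    using bij_betw_perm_append assms(1,2) .
  have "bij_betw ?f {z \<in> ?T. XDes X (card S) (?f z) - {m} = J}
      {\<pi> \<in> perms_of S. XDes X (card S) \<pi> - {m} = J}"
    \<comment> \<open>With \<open>perms_of S\<close> written as the image of \<open>?T\<close>, the
      target is the image of the filtered triples, and the bijection restricts.\<close>
    unfolding bij_betw_imp_surj_on[OF bij, symmetric]
    by (rule bij_betw_subset[OF bij]) (simp, blast)
  moreover have "{z \<in> ?T. XDes X (card S) (?f z) - {m} = J} = (SIGMA A:?\<A>. ?D J A \<times> ?D {} (S - A))"
  proof (intro set_eqI, clarify)
    fix A \<sigma> \<tau>
    show "(A, \<sigma>, \<tau>) \<in> {z \<in> ?T. XDes X (card S) (?f z) - {m} = J} \<longleftrightarrow>
        (A, \<sigma>, \<tau>) \<in> (SIGMA A:?\<A>. ?D J A \<times> ?D {} (S - A))"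
    \<comment> \<open>For admissible \<open>A\<close> the lengths \<open>card A\<close> and
      \<open>card (S - A)\<close> are \<open>m\<close> and \<open>card S - m\<close>, as the
      splitting criterion requires; otherwise neither side contains the triple.\<close>
    proof (cases "A \<in> ?\<A>")
      case True
      then show ?thesis
        by (simp add: card_diff XDes_perm_append_eq_iff[OF assms(2,3)] conj_ac)
    next
      case False
      then show ?thesis
        by blast
    qed
  qed
  ultimately have "card {\<pi> \<in> perms_of S. XDes X (card S) \<pi> - {m} = J} =
      card (SIGMA A:?\<A>. ?D J A \<times> ?D {} (S - A))"
    by (simp only: bij_betw_same_card)
  also have "\<dots> = (\<Sum>A\<in>?\<A>. card (?D J A \<times> ?D {} (S - A)))"
  proof (rule card_SigmaI)
    show "finite ?\<A>"
      using assms(1) by simp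
    show "\<forall>A\<in>?\<A>. finite (?D J A \<times> ?D {} (S - A))"
      using fin by (simp add: finite_perms_of)
  qed
  finally show ?thesis
    by (simp add: card_cartesian_product d_def)
qed

theorem theorem2p1:
  fixes X :: "(nat \<times> nat) set" and S I :: "nat set" and n m :: nat
  assumes "finite S" and "card S = n"
    and "I \<subseteq> {1..n - 1}" and "I \<noteq> {}"
    and "m = Max I"
  shows "int (d X I S) =
    (\<Sum>A\<in>{A. A \<subseteq> S \<and> card A = m}. int (d X (I - {m}) A) * int (d X {} (S - A)))
      - int (d X (I - {m}) S)"
proof -
  have "finite I"
    using assms(3) finite_subset by blast
  then have "m \<in> I" and Max: "\<And>i. i \<in> I \<Longrightarrow> i \<le> m"
    using assms(4,5) by auto
  then have "m \<le> card S"
    using assms(2,3) by fastforce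
  moreover have "I - {m} \<subseteq> {..<m}"
    using Max by (force simp: le_less)
  ultimately have "(\<Sum>A\<in>{A. A \<subseteq> S \<and> card A = m}. d X (I - {m}) A * d X {} (S - A)) =
      card {\<pi> \<in> perms_of S. XDes X (card S) \<pi> - {m} = I - {m}}"
    using card_XDes_except assms(1) by simp
  \<comment> \<open>Since \<open>m \<in> I\<close>, a set agreeing with \<open>I\<close> outside
    \<open>m\<close> is \<open>I\<close> or \<open>I - {m}\<close>, according to whether it contains
    \<open>m\<close>. The two cases exclude each other.\<close>
  also have "{\<pi> \<in> perms_of S. XDes X (card S) \<pi> - {m} = I - {m}} =
      {\<pi> \<in> perms_of S. XDes X (card S) \<pi> = I} \<union> {\<pi> \<in> perms_of S. XDes X (card S) \<pi> = I - {m}}"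
    using \<open>m \<in> I\<close> by auto
  also have "card \<dots> = d X I S + d X (I - {m}) S"
    unfolding d_def using assms(1) \<open>m \<in> I\<close>
    by (intro card_Un_disjoint) (auto simp: finite_perms_of)
  \<comment> \<open>The additive identity holds over the naturals; the cast to \<open>int\<close>
    lets one summand move across as a genuine subtraction.\<close>
  finally show ?thesis
    by (simp flip: of_nat_mult of_nat_sum)
qed

end
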